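(* Let $\mathcal H$ be a finite set of hypotheses $h:\mathcal X\to\mathcal Y=\{-1,1\}$, let $s:\mathcal H\to[0,1]$ be a score function that is testable using $\mathcal X$, and let $\epsilon,\delta\in[0,1]$. Then the following auditor is an $(\epsilon,\delta)$-auditor for $\mathcal H$ and $s$. It sets $\mathcal S:=\mathcal H$ and repeats: (i) if $s(h)>\epsilon$ for all $h\in\mathcal S$, stop and output $\texttt{Yes}$; if $s(h)\le\epsilon$ for all $h\in\mathcal S$, stop and output $\texttt{No}$; (ii) otherwise query a point $$x\in\arg\max_{x\in\mathcal X}\ \min_{(e,y)\in\mathcal E\times\mathcal Y}\frac{|\mathcal S|}{|\mathcal S_{x,y,e}|},$$ receive the label $y$ and explanation $e$ from the data scientist, and replace $\mathcal S$ by $\mathcal S_{x,y,e}$, where $\mathcal S_{x,y,e}=\{h\in\mathcal S: h(x)=y \text{ and } h \text{ is consistent with the explanation } e \text{ at } x\}$.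
   Context: Auditing protocol. A data scientist (DS) holds a hidden hypothesis $\bar h$ from a class $\mathcal H$ (known to the auditor) of functions $\mathcal X\to\{-1,1\}$. At each step the auditor sends a query $x\in\mathcal X$ (possibly depending on previous answers), and the DS truthfully returns the label $\bar h(x)$ and the explanation $e_{\bar h}(x)\in\mathcal E$, where $e_h:\mathcal X\to\mathcal E$ is an agreed explanation method. The auditor eventually stops and outputs $Y_a\in\{\texttt{Yes},\texttt{No}\}$. The auditor can evaluate $s(h)$ for any given $h$. $(\epsilon,\delta)$-auditor. An auditor is an $(\epsilon,\delta)$-auditor for $\mathcal H$ and $s$ if for every $h\in\mathcal H$ (as the hidden hypothesis): (1) if $s(h)>\epsilon$ then $\Pr(Y_a=\texttt{Yes})\ge 1-\delta$; (2) if $s(h)=0$ then $\Pr(Y_a=\texttt{No})=1$. Testability. $s$ is testable using $\mathcal X$ if for all $h_1,h_2\in\mathcal H$: $h_1(x)=h_2(x)$ for all $x\in\mathcal X$ implies $s(h_1)=s(h_2)$. Consistency. Whether $h$ is consistent with an explanation $e$ at $x$ is a check depending on the explanation method, with the property that $h$ is always consistent with its own explanation $e_h(x)$ at $x$ (for example, for counterfactual explanations $e=x'$, a hypothesis $h$ with $h(x)=\bar h(x)$ is consistent if $h(x')=\bar h(x')$). $|\cdot|$ is cardinality, and the ratio $|\mathcal S|/|\mathcal S_{x,y,e}|$ is $+\infty$ if $\mathcal S_{x,y,e}=\emptyset$. *)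

theory Defs
  imports "HOL-Probability.Probability" "HOL-Probability.SPMF"
begin

text \<open>
  Hypotheses are functions on the ambient type \<open>'x\<close>, labelled by \<open>-1\<close> and \<open>1\<close> on the query
  domain \<open>X\<close>. Two different hypotheses may agree on all of \<open>X\<close>, so that testability using
  \<open>X\<close> is a genuine condition on the score.
\<close>

type_synonym 'x hyp = "'x \<Rightarrow> int"

definition testable :: "'x set \<Rightarrow> 'x hyp set \<Rightarrow> ('x hyp \<Rightarrow> real) \<Rightarrow> bool" where
  "testable X H s \<longleftrightarrow>
     (\<forall>h1\<in>H. \<forall>h2\<in>H. (\<forall>x\<in>X. h1 x = h2 x) \<longrightarrow> s h1 = s h2)"

datatype verdict = Yes | No

datatype 'x action = Query 'x | Output verdict

type_synonym ('x, 'e) history = "('x \<times> int \<times> 'e) list"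

text \<open>
  An auditor is an adaptive, possibly randomised strategy: it maps the transcript so far
  (in chronological order) to a distribution over its next action.
\<close>

type_synonym ('x, 'e) auditor = "('x, 'e) history \<Rightarrow> 'x action pmf"

text \<open>
  The distribution of the verdict when the auditor \<open>A\<close> continues from a given transcript
  against a truthful data scientist with labels \<open>h\<close> and explanations \<open>eh\<close>. Missing
  probability mass stands for runs without a verdict: runs that never stop, and runs aborted
  because of a query outside \<open>X\<close>.
\<close>

partial_function (spmf) interact ::
  "'x set \<Rightarrow> 'x hyp \<Rightarrow> ('x \<Rightarrow> 'e) \<Rightarrow> ('x, 'e) auditor \<Rightarrow> ('x, 'e) history \<Rightarrow> verdict spmf"
where
  "interact X h eh A hist =
     bind_spmf (spmf_of_pmf (A hist))
       (\<lambda>a. case a of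
          Output v \<Rightarrow> return_spmf v
        | Query x \<Rightarrow>
            (if x \<in> X then interact X h eh A (hist @ [(x, h x, eh x)]) else return_pmf None))"

text \<open>
  Here \<open>expl h\<close> is the explanation function of the hypothesis \<open>h\<close>. The first conjunct is
  the protocol requirement that the auditor eventually stops; it also applies to hypotheses
  whose score lies in between, for which no particular verdict is required.
\<close>

definition eps_delta_auditor ::
  "'x set \<Rightarrow> 'x hyp set \<Rightarrow> ('x hyp \<Rightarrow> 'x \<Rightarrow> 'e) \<Rightarrow> ('x hyp \<Rightarrow> real) \<Rightarrow> real \<Rightarrow> real
     \<Rightarrow> ('x, 'e) auditor \<Rightarrow> bool"
where
  "eps_delta_auditor X H expl s \<epsilon> \<delta> A \<longleftrightarrow>
     (\<forall>h\<in>H. lossless_spmf (interact X h (expl h) A []) \<and>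
        (s h > \<epsilon> \<longrightarrow> spmf (interact X h (expl h) A []) Yes \<ge> 1 - \<delta>) \<and>
        (s h = 0 \<longrightarrow> spmf (interact X h (expl h) A []) No = 1))"

text \<open>
  \<open>cons h x e\<close> means that \<open>h\<close> is consistent with the explanation \<open>e\<close> at \<open>x\<close>. A check that
  also involves the label returned at \<open>x\<close> is covered, as it is only used when that label
  is \<open>h x\<close>.
\<close>

definition restrict_hyps ::
  "('x hyp \<Rightarrow> 'x \<Rightarrow> 'e \<Rightarrow> bool) \<Rightarrow> 'x hyp set \<Rightarrow> 'x \<Rightarrow> int \<Rightarrow> 'e \<Rightarrow> 'x hyp set"
where
  "restrict_hyps cons S x y e = {h \<in> S. h x = y \<and> cons h x e}"

definition reduction_ratio :: "'x hyp set \<Rightarrow> 'x hyp set \<Rightarrow> ereal" where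
  "reduction_ratio S S' = (if S' = {} then \<infinity> else ereal (real (card S) / real (card S')))"

text \<open>
  For finite \<open>S\<close> the ratio takes finitely many values, so the minimum below exists
  even when \<open>E\<close> is infinite.
\<close>

definition worst_ratio ::
  "'e set \<Rightarrow> ('x hyp \<Rightarrow> 'x \<Rightarrow> 'e \<Rightarrow> bool) \<Rightarrow> 'x hyp set \<Rightarrow> 'x \<Rightarrow> ereal"
where
  "worst_ratio E cons S x =
     Min ((\<lambda>(e, y). reduction_ratio S (restrict_hyps cons S x y e)) ` (E \<times> {-1, 1}))"

definition best_queries ::
  "'x set \<Rightarrow> 'e set \<Rightarrow> ('x hyp \<Rightarrow> 'x \<Rightarrow> 'e \<Rightarrow> bool) \<Rightarrow> 'x hyp set \<Rightarrow> 'x set"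
where
  "best_queries X E cons S = {x. is_arg_max (worst_ratio E cons S) (\<lambda>x. x \<in> X) x}"

definition current_hyps ::
  "'x hyp set \<Rightarrow> ('x hyp \<Rightarrow> 'x \<Rightarrow> 'e \<Rightarrow> bool) \<Rightarrow> ('x, 'e) history \<Rightarrow> 'x hyp set"
where
  "current_hyps H cons hist = fold (\<lambda>(x, y, e) S. restrict_hyps cons S x y e) hist H"

text \<open>
  \<open>pick\<close> is the rule for choosing among several maximisers; it may depend on the
  transcript and may be randomised.
\<close>

definition greedy_auditor ::
  "'x set \<Rightarrow> 'e set \<Rightarrow> 'x hyp set \<Rightarrow> ('x hyp \<Rightarrow> real) \<Rightarrow> ('x hyp \<Rightarrow> 'x \<Rightarrow> 'e \<Rightarrow> bool) \<Rightarrow> real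
     \<Rightarrow> (('x, 'e) history \<Rightarrow> 'x set \<Rightarrow> 'x pmf) \<Rightarrow> ('x, 'e) auditor"
where
  "greedy_auditor X E H s cons \<epsilon> pick hist =
     (let S = current_hyps H cons hist in
      if \<forall>h\<in>S. s h > \<epsilon> then return_pmf (Output Yes)
      else if \<forall>h\<in>S. s h \<le> \<epsilon> then return_pmf (Output No)
      else map_pmf Query (pick hist (best_queries X E cons S)))"

end

theory Submission
  imports Defs
begin

text \<open>
  The true hypothesis is never eliminated, so whenever the auditor stops, its verdict is the one
  determined by comparing the true score with \<open>\<epsilon>\<close>. It does stop: as long as the current set
  contains hypotheses on both sides of \<open>\<epsilon>\<close>, testability provides a point at which two of them
  differ, and there every answer has ratio above \<open>1\<close>. Hence the worst-case ratio of a greedy query is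
  above \<open>1\<close> as well, and every answer to it strictly shrinks the current set.
\<close>

lemma restrict_hyps_subset: "restrict_hyps cons S x y e \<subseteq> S"
  by (auto simp: restrict_hyps_def)

lemma current_hyps_snoc:
  "current_hyps H cons (hist @ [(x, y, e)]) = restrict_hyps cons (current_hyps H cons hist) x y e"
  by (simp add: current_hyps_def)

lemma current_hyps_subset: "current_hyps H cons hist \<subseteq> H"
proof (induction hist rule: rev_induct)
  case Nil
  then show ?case by (simp add: current_hyps_def)
next
  case (snoc a hist)
  then show ?case
    by (cases a) (use restrict_hyps_subset in \<open>fastforce simp: current_hyps_snoc\<close>)
qed

lemma reduction_ratio_self:
  assumes "finite S" "S \<noteq> {}"
  shows "reduction_ratio S S = 1"
  using assms by (simp add: reduction_ratio_def one_ereal_def)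

lemma reduction_ratio_gt_1:
  assumes "finite S" "S' \<subset> S"
  shows "reduction_ratio S S' > 1"
proof (cases "S' = {}")
  case False
  have "finite S'" using assms finite_subset by blast
  with False have "card S' > 0" by (simp add: card_gt_0_iff)
  with psubset_card_mono[OF assms] False show ?thesis
    by (simp add: reduction_ratio_def one_ereal_def)
qed (simp add: reduction_ratio_def)

text \<open>\<open>X\<close> and \<open>E\<close> may be infinite. This finite set contains every
  ratio of a subset of \<open>S\<close> and hence every attained minimum of such ratios, so
  \<open>Min\<close> and \<open>Max\<close> below are genuine extrema.\<close>

lemma finite_reduction_ratios:
  assumes "finite S" shows "finite (reduction_ratio S ` Pow S)"
  using assms by simp

lemma worst_ratio_mem:
  assumes "finite S" "E \<noteq> {}"
  shows "worst_ratio E cons S x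
    \<in> (\<lambda>(e, y). reduction_ratio S (restrict_hyps cons S x y e)) ` (E \<times> {-1, 1})"
    and "finite ((\<lambda>(e, y). reduction_ratio S (restrict_hyps cons S x y e)) ` (E \<times> {-1, 1}))"
proof -
  let ?R = "(\<lambda>(e, y). reduction_ratio S (restrict_hyps cons S x y e)) ` (E \<times> {-1, 1})"
  have "?R \<subseteq> reduction_ratio S ` Pow S"
    by (auto simp: restrict_hyps_def)
  then show fin: "finite ?R"
    using finite_reduction_ratios[OF assms(1)] by (rule finite_subset)
  show "worst_ratio E cons S x \<in> ?R"
    unfolding worst_ratio_def by (rule Min_in[OF fin]) (use assms in auto)
qed

lemma worst_ratio_le:
  assumes "finite S" "e \<in> E" "y \<in> {-1, 1}"
  shows "worst_ratio E cons S x \<le> reduction_ratio S (restrict_hyps cons S x y e)"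
proof -
  have "E \<noteq> {}" using assms by auto
  from worst_ratio_mem(2)[OF assms(1) this] show ?thesis
    unfolding worst_ratio_def by (rule Min_le) (use assms in force)
qed

text \<open>Whatever the answer, at most one of \<open>h1\<close> and \<open>h2\<close> carries the
  returned label, so the other is removed. This applies in particular to an answer attaining the
  minimum.\<close>

lemma worst_ratio_gt_1:
  assumes "finite S" "E \<noteq> {}" "h1 \<in> S" "h2 \<in> S" "h1 x \<noteq> h2 x"
  shows "worst_ratio E cons S x > 1"
proof -
  obtain e y where "worst_ratio E cons S x = reduction_ratio S (restrict_hyps cons S x y e)"
    using worst_ratio_mem(1)[OF assms(1,2), of cons x] by auto
  moreover have "restrict_hyps cons S x y e \<subset> S"
  proof (rule psubsetI[OF restrict_hyps_subset], rule notI)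
    assume "restrict_hyps cons S x y e = S"
    then have "h1 x = y" "h2 x = y"
      using assms(3,4) unfolding restrict_hyps_def by blast+
    then show False using assms(5) by simp
  qed
  ultimately show ?thesis
    using reduction_ratio_gt_1[OF assms(1)] by simp
qed

lemma best_queries_subset: "best_queries X E cons S \<subseteq> X"
  by (auto simp: best_queries_def is_arg_max_def)

text \<open>Worst-case ratios are attained, so they take finitely many values over \<open>X\<close>
  and some point reaches the largest. This matters because \<open>pick\<close> is constrained only
  on nonempty sets.\<close>

lemma best_queries_nonempty:
  assumes "finite S" "E \<noteq> {}" "X \<noteq> {}"
  shows "best_queries X E cons S \<noteq> {}"
proof -
  let ?W = "worst_ratio E cons S ` X"
  have "?W \<subseteq> reduction_ratio S ` Pow S"
    using worst_ratio_mem(1)[OF assms(1,2)] restrict_hyps_subset by fastforce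
  then have fin: "finite ?W"
    using finite_reduction_ratios[OF assms(1)] by (rule finite_subset)
  obtain x where "x \<in> X" "worst_ratio E cons S x = Max ?W"
    using Max_in[OF fin] assms(3) by fastforce
  then have "x \<in> best_queries X E cons S"
    using Max_ge[OF fin] by (auto simp: best_queries_def is_arg_max_def not_less)
  then show ?thesis by auto
qed

text \<open>The pair is separated at \<open>x'\<close>, not necessarily at \<open>x\<close>:
  maximality alone carries the bound above \<open>1\<close> over to \<open>x\<close>, and an answer
  that kept all of \<open>S\<close> would have ratio exactly \<open>1\<close>.\<close>

lemma greedy_query_shrinks:
  assumes "finite S" "h1 \<in> S" "h2 \<in> S" "x' \<in> X" "h1 x' \<noteq> h2 x'"
    and x: "x \<in> best_queries X E cons S" and "e \<in> E" "y \<in> {-1, 1}"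
  shows "restrict_hyps cons S x y e \<subset> S"
proof -
  have "worst_ratio E cons S x' \<le> worst_ratio E cons S x"
    using x \<open>x' \<in> X\<close> by (auto simp: best_queries_def is_arg_max_def not_less)
  moreover have "1 < worst_ratio E cons S x'"
    using assms(7) by (intro worst_ratio_gt_1[OF assms(1) _ assms(2,3,5)]) auto
  moreover have "worst_ratio E cons S x \<le> reduction_ratio S (restrict_hyps cons S x y e)"
    by (rule worst_ratio_le[OF assms(1,7,8)])
  ultimately have "1 < reduction_ratio S (restrict_hyps cons S x y e)"
    by simp
  then have "restrict_hyps cons S x y e \<noteq> S"
    using reduction_ratio_self[OF assms(1)] assms(2) by (metis empty_iff less_irrefl)
  then show ?thesis
    by (rule psubsetI[OF restrict_hyps_subset])
qed

text \<open>Starting from an arbitrary transcript makes induction possible; membership of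
  \<open>h\<close> in the current set is the invariant. The result is a point mass even for a
  randomised \<open>pick\<close>.\<close>

lemma interact_greedy_auditor:
  fixes H :: "'x hyp set" and expl :: "'x hyp \<Rightarrow> 'x \<Rightarrow> 'e"
  assumes "finite H"
    and labels: "\<And>h x. h \<in> H \<Longrightarrow> x \<in> X \<Longrightarrow> h x \<in> {-1, 1}"
    and "testable X H s"
    and expl: "\<And>h x. h \<in> H \<Longrightarrow> x \<in> X \<Longrightarrow> expl h x \<in> E"
    and cons: "\<And>h x. h \<in> H \<Longrightarrow> x \<in> X \<Longrightarrow> cons h x (expl h x)"
    and pick: "\<And>hist Q. Q \<noteq> {} \<Longrightarrow> set_pmf (pick hist Q) \<subseteq> Q"
    and "h \<in> current_hyps H cons hist"
  shows "interact X h (expl h) (greedy_auditor X E H s cons \<epsilon> pick) hist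
    = return_spmf (if s h > \<epsilon> then Yes else No)"
  using \<open>h \<in> current_hyps H cons hist\<close>
proof (induction "card (current_hyps H cons hist)" arbitrary: hist rule: less_induct)
  case less
  let ?A = "greedy_auditor X E H s cons \<epsilon> pick"
  let ?I = "interact X h (expl h) ?A"
  let ?v = "if s h > \<epsilon> then Yes else No"
  define S where "S = current_hyps H cons hist"
  have S: "S \<subseteq> H" "h \<in> S"
    using current_hyps_subset[of H cons hist] less.prems by (simp_all add: S_def)
  then have "h \<in> H" "finite S"
    using \<open>finite H\<close> finite_subset by auto
  show ?case
  proof (cases "(\<forall>g\<in>S. s g > \<epsilon>) \<or> (\<forall>g\<in>S. s g \<le> \<epsilon>)")
    case True
    \<comment> \<open>Since \<open>h\<close> itself lies in \<open>S\<close>, the unanimous side of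
      \<open>S\<close> is the side of \<open>s h\<close>.\<close>
    then have "?A hist = return_pmf (Output ?v)"
      using \<open>h \<in> S\<close> by (auto simp: greedy_auditor_def S_def[symmetric] not_less)
    then show ?thesis
      by (subst interact.simps) simp
  next
    case False
    then obtain h1 h2 where h12: "h1 \<in> S" "h2 \<in> S" "s h1 \<le> \<epsilon>" "s h2 > \<epsilon>"
      by (auto simp: not_less not_le)
    moreover have "s h1 \<noteq> s h2" using h12 by simp
    \<comment> \<open>Contrapositive of testability: different scores force different labels
      somewhere on \<open>X\<close>.\<close>
    ultimately obtain x' where x': "x' \<in> X" "h1 x' \<noteq> h2 x'"
      using \<open>testable X H s\<close> \<open>S \<subseteq> H\<close> unfolding testable_def by blast
    let ?Q = "best_queries X E cons S"
    have "E \<noteq> {}" using expl[OF \<open>h \<in> H\<close> x'(1)] by auto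
    with x'(1) have "?Q \<noteq> {}" by (intro best_queries_nonempty \<open>finite S\<close>) auto
    note picked = pick[OF this, of hist]
    have "\<not> (\<forall>g\<in>S. s g > \<epsilon>)" "\<not> (\<forall>g\<in>S. s g \<le> \<epsilon>)"
      using False by blast+
    then have A: "?A hist = map_pmf Query (pick hist ?Q)"
      unfolding greedy_auditor_def S_def[symmetric] Let_def by (simp only: if_False)
    have step: "x \<in> X \<and> ?I (hist @ [(x, h x, expl h x)]) = return_spmf ?v"
      if "x \<in> set_pmf (pick hist ?Q)" for x
    proof
      have x: "x \<in> ?Q" by (rule subsetD[OF picked that])
      then show "x \<in> X" by (rule subsetD[OF best_queries_subset])
      note answer = labels[OF \<open>h \<in> H\<close> this] expl[OF \<open>h \<in> H\<close> this] cons[OF \<open>h \<in> H\<close> this]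
      let ?S' = "current_hyps H cons (hist @ [(x, h x, expl h x)])"
      have S': "?S' = restrict_hyps cons S x (h x) (expl h x)"
        by (simp add: current_hyps_snoc S_def)
      have "?S' \<subset> S"
        unfolding S' using greedy_query_shrinks[OF \<open>finite S\<close> h12(1,2) x' x answer(2,1)] .
      then have "card ?S' < card S" by (rule psubset_card_mono[OF \<open>finite S\<close>])
      moreover have "h \<in> ?S'" using answer(3) \<open>h \<in> S\<close> by (simp add: S' restrict_hyps_def)
      ultimately show "?I (hist @ [(x, h x, expl h x)]) = return_spmf ?v"
        using less.hyps unfolding S_def by blast
    qed
    have "?I hist = bind_pmf (pick hist ?Q)
        (\<lambda>x. if x \<in> X then ?I (hist @ [(x, h x, expl h x)]) else return_pmf None)"
      by (subst interact.simps) (simp add: A bind_map_pmf)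
    \<comment> \<open>Every point in the support of \<open>pick\<close> leads to the same verdict,
      so the random choice among maximisers integrates out.\<close>
    also have "\<dots> = bind_pmf (pick hist ?Q) (\<lambda>_. return_spmf ?v)"
      by (rule bind_pmf_cong) (use step in auto)
    finally show ?thesis by simp
  qed
qed

theorem theorem5:
  fixes X :: "'x set" and E :: "'e set" and H :: "('x \<Rightarrow> int) set"
    and s :: "('x \<Rightarrow> int) \<Rightarrow> real"
    and expl :: "('x \<Rightarrow> int) \<Rightarrow> 'x \<Rightarrow> 'e"
    and cons :: "('x \<Rightarrow> int) \<Rightarrow> 'x \<Rightarrow> 'e \<Rightarrow> bool"
    and pick :: "('x \<times> int \<times> 'e) list \<Rightarrow> 'x set \<Rightarrow> 'x pmf"
    and \<epsilon> \<delta> :: real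
  assumes "finite H"
    and "\<And>h x. h \<in> H \<Longrightarrow> x \<in> X \<Longrightarrow> h x \<in> {-1, 1}"
    and "\<And>h. h \<in> H \<Longrightarrow> s h \<in> {0..1}"
    and "testable X H s"
    and "\<epsilon> \<in> {0..1}" and "\<delta> \<in> {0..1}"
    and "\<And>h x. h \<in> H \<Longrightarrow> x \<in> X \<Longrightarrow> expl h x \<in> E"
    and "\<And>h x. h \<in> H \<Longrightarrow> x \<in> X \<Longrightarrow> cons h x (expl h x)"
    and "\<And>hist Q. Q \<noteq> {} \<Longrightarrow> set_pmf (pick hist Q) \<subseteq> Q"
  shows "eps_delta_auditor X H expl s \<epsilon> \<delta> (greedy_auditor X E H s cons \<epsilon> pick)"
  unfolding eps_delta_auditor_def
proof
  fix h assume "h \<in> H"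
  then have "h \<in> current_hyps H cons []" by (simp add: current_hyps_def)
  then have run: "interact X h (expl h) (greedy_auditor X E H s cons \<epsilon> pick) []
      = return_spmf (if s h > \<epsilon> then Yes else No)"
    by (intro interact_greedy_auditor assms(1,2,4,7-9))
  show "lossless_spmf (interact X h (expl h) (greedy_auditor X E H s cons \<epsilon> pick) []) \<and>
      (s h > \<epsilon> \<longrightarrow>
        spmf (interact X h (expl h) (greedy_auditor X E H s cons \<epsilon> pick) []) Yes \<ge> 1 - \<delta>) \<and>
      (s h = 0 \<longrightarrow>
        spmf (interact X h (expl h) (greedy_auditor X E H s cons \<epsilon> pick) []) No = 1)"
    \<comment> \<open>A zero score does not exceed \<open>\<epsilon>\<close> because
      \<open>\<epsilon>\<close> is nonnegative, and probability \<open>1\<close> meets the bound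
      \<open>1 - \<delta>\<close> because \<open>\<delta>\<close> is nonnegative.\<close>
    using assms(5,6) by (simp add: run)
qed

end
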